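(* For every $n\in\mathbb{N}$, the polynomial $e_n$ of degree $n$ satisfying $e_n'(x)+e_n(x)=x^n$ is given, for $x\neq 0$, by the Rodrigues formula $$e_n(x)=x^{n+1}e^{-x}\,\frac{d^n}{dx^n}\left(x^{-1}e^{x}\right).$$
   Context: $\mathbb{N}=\{0,1,2,\dots\}$. The polynomials $e_n$ are those for which $\int x^n e^x\,dx=e_n(x)e^x+\text{constant}$, equivalently $e_n'+e_n=x^n$. *)

theory Defs
  imports "HOL-Analysis.Analysis" "HOL-Computational_Algebra.Polynomial"
begin

text \<open>
  The polynomial \<open>e\<^sub>n\<close> with \<open>e\<^sub>n' + e\<^sub>n = x\<^sup>n\<close>. The description says nothing about the
  degree, which is a theorem; so are existence and uniqueness, without which \<open>THE\<close>
  would denote an unspecified value.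
\<close>

definition e_poly :: "nat \<Rightarrow> real poly" where
  "e_poly n = (THE p. pderiv p + p = monom 1 n)"

end

(* Both sides obey the recursion e_(n+1) = x^(n+1) - (n+1) e_n: the polynomials by
   uniqueness, since p' + p has the same degree as p, and the Rodrigues expression because
   differentiating e_n x^(-n-1) e^x produces (e_n' + e_n) x^(-n-1) e^x - (n+1) e_n x^(-n-2) e^x,
   where e_n' + e_n = x^n. *)

theory Submission
  imports Defs
begin

text \<open>In positive degree differentiation strictly lowers the degree, so the leading term of
  \<open>p\<close> survives. Constants are treated apart: there \<open>pderiv p\<close> is zero,
  which also has degree 0, so the degree does not drop.\<close>

lemma degree_pderiv_add_self:
  fixes p :: "real poly"
  shows "degree (pderiv p + p) = degree p"
proof (cases "degree p = 0")
  case True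
  then have "pderiv p = 0"
    by (simp add: pderiv_eq_0_iff)
  then show ?thesis
    by simp
next
  case False
  then show ?thesis
    by (intro degree_add_eq_right) (simp add: degree_pderiv)
qed

text \<open>Degree preservation only makes \<open>p\<close> constant, as 0 and nonzero constants
  share degree 0. The derivative then vanishes and the equation itself gives
  \<open>p = 0\<close>.\<close>

lemma pderiv_add_self_eq_0_iff:
  fixes p :: "real poly"
  shows "pderiv p + p = 0 \<longleftrightarrow> p = 0"
proof
  assume *: "pderiv p + p = 0"
  then have "degree p = 0"
    using degree_pderiv_add_self[of p] by simp
  then have "pderiv p = 0"
    by (simp add: pderiv_eq_0_iff)
  with * show "p = 0"
    by simp
qed simp

lemma pderiv_add_self_inject:
  fixes p q :: "real poly"
  assumes "pderiv p + p = pderiv q + q"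
  shows "p = q"
proof -
  have "pderiv (p - q) + (p - q) = 0"
    using assms by (simp add: pderiv_diff algebra_simps)
  then show ?thesis
    by (simp only: pderiv_add_self_eq_0_iff right_minus_eq)
qed

text \<open>The operator \<open>p' + p\<close> maps x^(n+1) to x^(n+1) + (n+1) x^n, and the surplus
  is removed by n+1 times a preimage of x^n. This serves both the existence induction and the
  recursion for \<open>e_poly\<close>.\<close>

lemma pderiv_add_self_step:
  fixes p :: "real poly"
  assumes "pderiv p + p = monom 1 n"
  shows "pderiv (monom 1 (Suc n) - smult (of_nat (Suc n)) p) +
    (monom 1 (Suc n) - smult (of_nat (Suc n)) p) = monom 1 (Suc n)"
proof -
  have "smult (of_nat (Suc n)) (pderiv p) + smult (of_nat (Suc n)) p = monom (of_nat (Suc n)) n"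
    by (simp only: smult_add_right[symmetric] assms smult_monom mult_1_right)
  then show ?thesis
    by (simp add: pderiv_diff pderiv_monom pderiv_smult algebra_simps del: of_nat_Suc)
qed

lemma ex1_pderiv_add_self_eq_monom:
  "\<exists>!p :: real poly. pderiv p + p = monom 1 n"
proof (rule ex_ex1I)
  show "\<exists>p :: real poly. pderiv p + p = monom 1 n"
  proof (induction n)
    case 0
    have "pderiv (1 :: real poly) + 1 = monom 1 0"
      by (simp add: monom_0 one_pCons)
    then show ?case ..
  next
    case (Suc n)
    then show ?case
      using pderiv_add_self_step by blast
  qed
qed (rule pderiv_add_self_inject, simp)

lemma pderiv_add_e_poly: "pderiv (e_poly n) + e_poly n = monom 1 n"
  unfolding e_poly_def by (rule theI') (rule ex1_pderiv_add_self_eq_monom)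

lemma degree_e_poly: "degree (e_poly n) = n"
  using degree_pderiv_add_self[of "e_poly n"]
  by (simp add: pderiv_add_e_poly degree_monom_eq)

lemma e_poly_0: "e_poly 0 = 1"
  by (rule pderiv_add_self_inject) (simp add: pderiv_add_e_poly monom_0 one_pCons)

lemma e_poly_Suc:
  "e_poly (Suc n) = monom 1 (Suc n) - smult (of_nat (Suc n)) (e_poly n)"
  by (rule pderiv_add_self_inject)
    (simp only: pderiv_add_e_poly pderiv_add_self_step[OF pderiv_add_e_poly])

lemma has_real_derivative_e_poly_exp:
  fixes x :: real
  assumes "x \<noteq> 0"
  shows "((\<lambda>t. poly (e_poly n) t * exp t / t ^ Suc n) has_real_derivative
    poly (e_poly (Suc n)) x * exp x / x ^ Suc (Suc n)) (at x)"
proof -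
  have "poly (pderiv (e_poly n)) x + poly (e_poly n) x = x ^ n"
    by (metis pderiv_add_e_poly poly_add poly_monom mult_1)
  then have e: "poly (pderiv (e_poly n)) x = x ^ n - poly (e_poly n) x"
    by simp
  \<comment> \<open>Grouping \<open>exp\<close> with the polynomial first lets the defining equation
    collapse the product rule to a single monomial times \<open>exp\<close>.\<close>
  have "((\<lambda>t. poly (e_poly n) t * exp t) has_real_derivative x ^ n * exp x) (at x)"
    by (rule derivative_eq_intros poly_DERIV refl)+ (simp add: e algebra_simps)
  moreover have "((\<lambda>t. t ^ Suc n) has_real_derivative of_nat (Suc n) * x ^ n) (at x)"
    using DERIV_pow[of "Suc n" x] by simp
  ultimately have "((\<lambda>t. poly (e_poly n) t * exp t / t ^ Suc n) has_real_derivative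
      (x ^ n * exp x * x ^ Suc n - poly (e_poly n) x * exp x * (of_nat (Suc n) * x ^ n)) /
      (x ^ Suc n * x ^ Suc n)) (at x)"
    using assms by (intro DERIV_divide) simp_all
  \<comment> \<open>Pulling x^n out of numerator and denominator lowers the exponent from 2n+2 to
    n+2 and leaves the right-hand side of \<open>e_poly_Suc\<close> in the numerator.\<close>
  also have "(x ^ n * exp x * x ^ Suc n - poly (e_poly n) x * exp x * (of_nat (Suc n) * x ^ n)) /
      (x ^ Suc n * x ^ Suc n) =
      (x ^ n * (exp x * (x ^ Suc n - of_nat (Suc n) * poly (e_poly n) x))) /
      (x ^ n * x ^ Suc (Suc n))"
    by (simp add: right_diff_distrib mult_ac del: of_nat_Suc)
  also have "\<dots> = poly (e_poly (Suc n)) x * exp x / x ^ Suc (Suc n)"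
    using assms by (simp add: e_poly_Suc poly_monom mult.commute del: of_nat_Suc)
  finally show ?thesis .
qed

lemma higher_deriv_inverse_times_exp:
  fixes x :: real
  assumes "x \<noteq> 0"
  shows "(deriv ^^ n) (\<lambda>t. inverse t * exp t) x = poly (e_poly n) x * exp x / x ^ Suc n"
  using assms
proof (induction n arbitrary: x)
  case 0
  then show ?case
    by (simp add: e_poly_0 field_simps)
next
  case (Suc n)
  \<comment> \<open>Equality at \<open>x\<close> alone says nothing about derivatives. The induction
    hypothesis, general in the point, is therefore used on a whole neighbourhood of \<open>x\<close>
    that avoids 0.\<close>
  have "eventually (\<lambda>t. t \<noteq> 0) (nhds x)"
    using Suc.prems by (intro t1_space_nhds)
  then have "eventually (\<lambda>t. (deriv ^^ n) (\<lambda>t. inverse t * exp t) t =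
      poly (e_poly n) t * exp t / t ^ Suc n) (nhds x)"
    by eventually_elim (rule Suc.IH)
  then have "deriv ((deriv ^^ n) (\<lambda>t. inverse t * exp t)) x =
      deriv (\<lambda>t. poly (e_poly n) t * exp t / t ^ Suc n) x"
    by (rule deriv_cong_ev) simp
  also have "\<dots> = poly (e_poly (Suc n)) x * exp x / x ^ Suc (Suc n)"
    by (rule DERIV_imp_deriv[OF has_real_derivative_e_poly_exp[OF Suc.prems]])
  finally show ?case
    by simp
qed

theorem mainTheorem5:
  fixes n :: nat
  shows "(\<exists>!p :: real poly. pderiv p + p = monom 1 n) \<and>
    pderiv (e_poly n) + e_poly n = monom 1 n \<and>
    degree (e_poly n) = n \<and>
    (\<forall>x :: real. x \<noteq> 0 \<longrightarrow>
      poly (e_poly n) x =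
        x ^ (n + 1) * exp (- x) * (deriv ^^ n) (\<lambda>t :: real. inverse t * exp t) x)"
proof (intro conjI allI impI)
  fix x :: real
  assume "x \<noteq> 0"
  then show "poly (e_poly n) x =
      x ^ (n + 1) * exp (- x) * (deriv ^^ n) (\<lambda>t :: real. inverse t * exp t) x"
    by (simp add: higher_deriv_inverse_times_exp exp_minus)
qed (rule ex1_pderiv_add_self_eq_monom pderiv_add_e_poly degree_e_poly)+

end
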